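(* Let $k,l\in(0,1)$. For every $q\in\mathbb C\setminus\{0\}$, the function $$e_q(p):=\log\frac{|p-q|}{|p|^k|q|^l},\qquad p\in\mathbb C\setminus\{0\},\ p\neq q,$$ is an Evans-Selberg potential on $\mathbb C\setminus\{0\}$ with pole $q$.
   Context: Let $\Sigma$ be an open Riemann surface and $q\in\Sigma$. An Evans-Selberg potential on $\Sigma$ with pole $q$ is a real-valued function $E_q(p)$ such that: (i) $E_q(p)$ is harmonic in $p$ on $\Sigma\setminus\{q\}$; (ii) $E_q(p)-\log|\varphi(p)-\varphi(q)|$ is bounded near $q$, where $\varphi$ is a local coordinate; (iii) $E_q(p)\to+\infty$ as $p\to a_\infty$, the Alexandroff ideal boundary point of $\Sigma$ (i.e. the point at infinity of the one-point compactification of $\Sigma$). *)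

theory Defs
  imports "HOL-Complex_Analysis.Complex_Analysis"
begin

section \<open>Riemann surfaces\<close>

text \<open>A chart is a pair of its domain and the coordinate map. Values of the coordinate map outside
  the domain are irrelevant.\<close>

type_synonym 'a chart = "'a set \<times> ('a \<Rightarrow> complex)"

definition is_chart :: "'a topology \<Rightarrow> 'a chart \<Rightarrow> bool" where
  "is_chart X = (\<lambda>(U, \<phi>). openin X U \<and> open (\<phi> ` U) \<and>
     homeomorphic_map (subtopology X U) (top_of_set (\<phi> ` U)) \<phi>)"

definition chart_compatible :: "'a chart \<Rightarrow> 'a chart \<Rightarrow> bool" where
  "chart_compatible = (\<lambda>(U, \<phi>) (V, \<psi>).
     (\<psi> \<circ> inv_into U \<phi>) holomorphic_on (\<phi> ` (U \<inter> V)) \<and>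
     (\<phi> \<circ> inv_into V \<psi>) holomorphic_on (\<psi> ` (U \<inter> V)))"

definition riemann_surface :: "'a topology \<Rightarrow> 'a chart set \<Rightarrow> bool" where
  "riemann_surface X \<A> \<longleftrightarrow>
     topspace X \<noteq> {} \<and> connected_space X \<and> Hausdorff_space X \<and>
     (\<forall>c\<in>\<A>. is_chart X c) \<and> (\<Union>c\<in>\<A>. fst c) = topspace X \<and>
     (\<forall>c\<in>\<A>. \<forall>d\<in>\<A>. chart_compatible c d)"

definition open_riemann_surface :: "'a topology \<Rightarrow> 'a chart set \<Rightarrow> bool" where
  "open_riemann_surface X \<A> \<longleftrightarrow> riemann_surface X \<A> \<and> \<not> compact_space X"

text \<open>The local coordinates are the members of the maximal atlas containing \<open>\<A>\<close>, not only the
  charts listed in \<open>\<A>\<close>.\<close>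

definition local_coordinate :: "'a topology \<Rightarrow> 'a chart set \<Rightarrow> 'a chart \<Rightarrow> bool" where
  "local_coordinate X \<A> c \<longleftrightarrow> is_chart X c \<and> (\<forall>d\<in>\<A>. chart_compatible c d)"

text \<open>The complex structure that an open subset of the plane inherits from the plane.\<close>

definition planar_atlas :: "complex set \<Rightarrow> complex chart set" where
  "planar_atlas S = {(S, \<lambda>z. z)}"

section \<open>Harmonic functions\<close>

text \<open>A harmonic function on an open plane set is \<open>C\<^sup>2\<close> with vanishing Laplacian. Here \<open>ux\<close>, \<open>uy\<close>
  are the first and \<open>uxx\<close>, \<open>uxy\<close>, \<open>uyx\<close>, \<open>uyy\<close> the second partial derivatives (\<open>uxy\<close> is the
  \<open>y\<close>-derivative of \<open>ux\<close>).\<close>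

definition harmonic_on_plane :: "(complex \<Rightarrow> real) \<Rightarrow> complex set \<Rightarrow> bool" where
  "harmonic_on_plane u S \<longleftrightarrow> open S \<and>
     (\<exists>ux uy uxx uxy uyx uyy.
        (\<forall>z\<in>S.
           (u has_derivative (\<lambda>h. ux z * Re h + uy z * Im h)) (at z) \<and>
           (ux has_derivative (\<lambda>h. uxx z * Re h + uxy z * Im h)) (at z) \<and>
           (uy has_derivative (\<lambda>h. uyx z * Re h + uyy z * Im h)) (at z) \<and>
           uxx z + uyy z = 0) \<and>
        continuous_on S uxx \<and> continuous_on S uxy \<and>
        continuous_on S uyx \<and> continuous_on S uyy)"

definition harmonic_on_surface ::
  "'a topology \<Rightarrow> 'a chart set \<Rightarrow> ('a \<Rightarrow> real) \<Rightarrow> 'a set \<Rightarrow> bool" where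
  "harmonic_on_surface X \<A> u W \<longleftrightarrow> openin X W \<and>
     (\<forall>U \<phi>. local_coordinate X \<A> (U, \<phi>) \<longrightarrow>
        harmonic_on_plane (u \<circ> inv_into U \<phi>) (\<phi> ` (U \<inter> W)))"

section \<open>Evans-Selberg potentials\<close>

text \<open>The filter \<open>atin X q\<close> consists of punctured neighbourhoods, so the value \<open>E q\<close> plays no role.
  The ideal boundary point is the point \<open>None\<close> of the Alexandroff compactification; the values of
  \<open>the\<close> are only used at points \<open>Some p\<close>.\<close>

definition evans_selberg_potential ::
  "'a topology \<Rightarrow> 'a chart set \<Rightarrow> 'a \<Rightarrow> ('a \<Rightarrow> real) \<Rightarrow> bool" where
  "evans_selberg_potential X \<A> q E \<longleftrightarrow>
     open_riemann_surface X \<A> \<and> q \<in> topspace X \<and>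
     harmonic_on_surface X \<A> E (topspace X - {q}) \<and>
     (\<forall>U \<phi>. local_coordinate X \<A> (U, \<phi>) \<and> q \<in> U \<longrightarrow>
        (\<exists>M. \<forall>\<^sub>F p in atin X q. \<bar>E p - ln (cmod (\<phi> p - \<phi> q))\<bar> \<le> M)) \<and>
     filterlim (\<lambda>x. E (the x)) at_top (atin (Alexandroff_compactification X) None)"

end

theory Submission
  imports Defs
begin

text \<open>
  On \<open>\<complex> - {0, q}\<close> the function equals \<open>ln |p - q| - k ln |p| - l ln |q|\<close>. Read in a local coordinate
  with inverse \<open>g\<close>, its first partial derivatives are the real part and minus the imaginary part of
  the holomorphic function \<open>g' / (g - q) - k g' / g\<close>, so that harmonicity reduces to the
  Cauchy-Riemann equations (\<open>harmonic_on_plane_of_holomorphic_gradient\<close>). At \<open>q\<close>, a local coordinate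
  \<open>\<phi>\<close> is an injective holomorphic function, hence \<open>(\<phi> p - \<phi> q) / (p - q)\<close> tends to
  \<open>\<phi>'(q) \<noteq> 0\<close> and its logarithm stays bounded. The ideal boundary point is approached exactly when
  \<open>p\<close> tends to \<open>0\<close> or to \<open>\<infinity>\<close>: at \<open>0\<close> the term \<open>-k ln |p|\<close> dominates and tends to \<open>+\<infinity>\<close> because \<open>k > 0\<close>,
  and at \<open>\<infinity>\<close> the function is asymptotic to \<open>(1 - k) ln |p|\<close>, which tends to \<open>+\<infinity>\<close> because \<open>k < 1\<close>.
\<close>

section \<open>Harmonicity from the Cauchy-Riemann equations\<close>

text \<open>A function whose gradient is the conjugate of a holomorphic function \<open>F\<close> is harmonic: its
  second partial derivatives are read off \<open>F'\<close>, and its Laplacian is \<open>Re F' - Re F' = 0\<close>.\<close>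

lemma harmonic_on_plane_of_holomorphic_gradient:
  assumes "open S" and F: "F holomorphic_on S"
    and u: "\<And>z. z \<in> S \<Longrightarrow> (u has_derivative (\<lambda>h. Re (F z * h))) (at z)"
  shows "harmonic_on_plane u S"
proof -
  have dF: "(F has_derivative (\<lambda>h. deriv F z * h)) (at z)" if "z \<in> S" for z
    using holomorphic_derivI[OF F \<open>open S\<close> that] by (simp add: has_field_derivative_def)
  have dRe: "((\<lambda>z. Re (F z)) has_derivative
      (\<lambda>h. Re (deriv F z) * Re h + - Im (deriv F z) * Im h)) (at z)" if "z \<in> S" for z
    using has_derivative_Re[OF dF[OF that]] by simp
  have dIm: "((\<lambda>z. - Im (F z)) has_derivative
      (\<lambda>h. - Im (deriv F z) * Re h + - Re (deriv F z) * Im h)) (at z)" if "z \<in> S" for z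
    using has_derivative_minus[OF has_derivative_Im[OF dF[OF that]]] by (simp add: algebra_simps)
  have "continuous_on S (deriv F)"
    by (intro holomorphic_on_imp_continuous_on holomorphic_deriv F \<open>open S\<close>)
  then have cont: "continuous_on S (\<lambda>z. Re (deriv F z))" "continuous_on S (\<lambda>z. - Im (deriv F z))"
    "continuous_on S (\<lambda>z. - Re (deriv F z))"
    by (auto intro!: continuous_intros)
  have du: "(u has_derivative (\<lambda>h. Re (F z) * Re h + - Im (F z) * Im h)) (at z)" if "z \<in> S" for z
    using u[OF that] by simp
  show ?thesis
    unfolding harmonic_on_plane_def
    by (intro conjI \<open>open S\<close> exI[of _ "\<lambda>z. Re (F z)"] exI[of _ "\<lambda>z. - Im (F z)"]
        exI[of _ "\<lambda>z. Re (deriv F z)"] exI[of _ "\<lambda>z. - Im (deriv F z)"]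
        exI[of _ "\<lambda>z. - Re (deriv F z)"] ballI du dRe dIm cont) simp_all
qed

lemma has_derivative_ln_cmod:
  assumes "(f has_field_derivative f') (at z)" and "f z \<noteq> 0"
  shows "((\<lambda>z. ln (cmod (f z))) has_derivative (\<lambda>h. Re (f' / f z * h))) (at z)"
proof -
  have inner_sgn: "sgn w \<bullet> v / cmod w = Re (v / w)" for w v :: complex
    by (simp add: sgn_div_norm inner_complex_def Re_divide flip: cmod_power2)
       (simp add: power2_eq_square divide_inverse algebra_simps)
  have "((\<lambda>z. cmod (f z)) has_derivative (\<lambda>h. sgn (f z) \<bullet> (f' * h))) (at z)"
    using has_derivative_compose[OF assms(1)[unfolded has_field_derivative_def]
        has_derivative_norm[OF assms(2)]]
    by (simp add: inner_commute)
  then have "((\<lambda>z. ln (cmod (f z))) has_derivative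
      (\<lambda>h. (sgn (f z) \<bullet> (f' * h)) * inverse (cmod (f z)))) (at z)"
    using has_derivative_ln[of "\<lambda>z. cmod (f z)"] assms(2) by fastforce
  then show ?thesis
    by (simp only: inner_sgn times_divide_eq_left flip: divide_inverse)
qed

section \<open>Plane domains as Riemann surfaces\<close>

text \<open>The complements of closed annuli around \<open>0\<close>, with the point \<open>None\<close> added, form a
  neighbourhood base of the ideal boundary point of the punctured plane. Hence a limit along both
  \<open>p \<rightarrow> 0\<close> and \<open>p \<rightarrow> \<infinity>\<close> is a limit at the ideal boundary point.\<close>

lemma filterlim_ideal_boundary_punctured_plane:
  fixes f :: "complex \<Rightarrow> 'b"
  assumes "filterlim f F (at 0)" and "filterlim f F at_infinity"
  shows "filterlim (\<lambda>x. f (the x)) F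
           (atin (Alexandroff_compactification (top_of_set (UNIV - {0}))) None)"
  unfolding filterlim_iff
proof (intro allI impI)
  fix P assume P: "eventually P F"
  obtain r where r: "r > 0" "\<And>p. p \<noteq> 0 \<Longrightarrow> cmod p < r \<Longrightarrow> P (f p)"
    using filterlim_iff[THEN iffD1, OF assms(1)] P by (auto simp: eventually_at)
  obtain R where R: "\<And>p. R \<le> cmod p \<Longrightarrow> P (f p)"
    using filterlim_iff[THEN iffD1, OF assms(2)] P by (auto simp: eventually_at_infinity)
  define C where "C = cball (0::complex) R - ball 0 r"
  have "compact C" "C \<subseteq> UNIV - {0}"
    using r(1) by (auto simp: C_def intro: compact_diff)
  then have C: "compactin (top_of_set (UNIV - {0})) C" "closedin (top_of_set (UNIV - {0})) C"
    by (simp_all add: compactin_subtopology closed_subset compact_imp_closed)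
  let ?V = "insert None (Some ` (UNIV - {0} - C))"
  have "openin (Alexandroff_compactification (top_of_set (UNIV - {0}))) ?V"
    using C by (auto simp: openin_Alexandroff_compactification)
  moreover have "P (f (the x))" if "x \<in> ?V - {None}" for x
    using that r(2) R unfolding C_def by auto (meson linear)
  ultimately show "\<forall>\<^sub>F x in atin (Alexandroff_compactification (top_of_set (UNIV - {0}))) None.
      P (f (the x))"
    unfolding eventually_atin by blast
qed

lemma open_riemann_surface_planar:
  assumes "open S" "connected S" "S \<noteq> {}" "\<not> compact S"
  shows "open_riemann_surface (top_of_set S) (planar_atlas S)"
proof -
  have "homeomorphic_map (top_of_set S) (top_of_set S) (\<lambda>z. z)"
    using homeomorphic_map_id[of "top_of_set S"] by (simp add: id_def)
  then have "is_chart (top_of_set S) (S, \<lambda>z. z)"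
    using \<open>open S\<close> by (simp add: is_chart_def subtopology_subtopology)
  moreover have "inv_into S (\<lambda>z. z) z = z" if "z \<in> S" for z
    using that by (metis f_inv_into_f image_ident)
  then have "inv_into S (\<lambda>z. z) holomorphic_on S"
    by (metis (no_types, lifting) holomorphic_cong holomorphic_on_ident)
  then have "chart_compatible (S, \<lambda>z. z) (S, \<lambda>z. z)"
    by (simp add: chart_compatible_def o_def)
  ultimately show ?thesis
    using assms
    by (simp add: open_riemann_surface_def riemann_surface_def planar_atlas_def
        Hausdorff_space_subtopology connected_space_subtopology compact_space_subtopology
        compact_space_def compactin_subtopology connectedin_iff_connected)
qed

text \<open>A local coordinate of an open plane set \<open>S\<close> is an injective holomorphic function on an open
  subset of \<open>S\<close>, with holomorphic inverse.\<close>

lemma local_coordinate_planarD: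
  assumes "open S" and "local_coordinate (top_of_set S) (planar_atlas S) (U, \<phi>)"
  shows "U \<subseteq> S" "open U" "open (\<phi> ` U)" "inj_on \<phi> U" "\<phi> holomorphic_on U"
    "inv_into U \<phi> holomorphic_on (\<phi> ` U)"
proof -
  have chart: "openin (top_of_set S) U" "open (\<phi> ` U)"
    "homeomorphic_map (subtopology (top_of_set S) U) (top_of_set (\<phi> ` U)) \<phi>"
    and compat: "chart_compatible (U, \<phi>) (S, \<lambda>z. z)"
    using assms(2) by (auto simp: local_coordinate_def is_chart_def planar_atlas_def)
  show "U \<subseteq> S" "open (\<phi> ` U)"
    using chart openin_imp_subset by auto
  then have "U \<inter> S = U" by auto
  show "open U"
    using chart(1) \<open>open S\<close> openin_open_eq by blast
  show "inj_on \<phi> U"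
    using homeomorphic_imp_injective_map[OF chart(3)] \<open>U \<subseteq> S\<close> by (simp add: inf_absorb2)
  have inv_S: "inv_into S (\<lambda>z. z) z = z" if "z \<in> S" for z
    using that by (metis f_inv_into_f image_ident)
  have "(\<phi> \<circ> inv_into S (\<lambda>z. z)) holomorphic_on U"
    using compat \<open>U \<inter> S = U\<close> by (simp add: chart_compatible_def Int_commute)
  then show "\<phi> holomorphic_on U"
    using inv_S \<open>U \<subseteq> S\<close> by (subst holomorphic_cong[OF refl]) auto
  show "inv_into U \<phi> holomorphic_on (\<phi> ` U)"
    using compat \<open>U \<inter> S = U\<close> by (simp add: chart_compatible_def o_def)
qed

section \<open>The potential on the punctured plane\<close>

lemma eventually_abs_le_of_tendsto:
  fixes f :: "'a \<Rightarrow> real"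
  assumes "(f \<longlongrightarrow> L) F"
  shows "\<exists>M. \<forall>\<^sub>F x in F. \<bar>f x\<bar> \<le> M"
proof
  show "\<forall>\<^sub>F x in F. \<bar>f x\<bar> \<le> \<bar>L\<bar> + 1"
    using tendstoD[OF assms zero_less_one] by eventually_elim (auto simp: dist_real_def)
qed

theorem theorem1p1:
  fixes k l :: real and q :: complex
  assumes "0 < k" "k < 1" "0 < l" "l < 1"
    and "q \<noteq> 0"
  shows "evans_selberg_potential (top_of_set (UNIV - {0})) (planar_atlas (UNIV - {0})) q
           (\<lambda>p. ln (cmod (p - q) / (cmod p powr k * cmod q powr l)))"
proof -
  let ?S = "UNIV - {0::complex}"
  let ?E = "\<lambda>p. ln (cmod (p - q) / (cmod p powr k * cmod q powr l))"
  define c where "c = l * ln (cmod q)"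
  have "open ?S" by auto
  have E: "?E p = ln (cmod (p - q)) - k * ln (cmod p) - c" if "p \<noteq> 0" "p \<noteq> q" for p
    using that \<open>q \<noteq> 0\<close> by (simp add: ln_div ln_mult ln_powr c_def)

  have "\<not> compact ?S"
  proof
    assume "compact ?S"
    then have "bounded (insert 0 ?S)"
      by (simp only: bounded_insert compact_imp_bounded)
    moreover have "insert 0 ?S = UNIV" by auto
    ultimately show False
      using not_bounded_UNIV by metis
  qed
  moreover have "connected ?S"
    using connected_punctured_universe[of "0::complex"] by (simp add: Compl_eq_Diff_UNIV)
  moreover have "(1::complex) \<in> ?S" by simp
  ultimately have surface: "open_riemann_surface (top_of_set ?S) (planar_atlas ?S)"
    using \<open>open ?S\<close> by (intro open_riemann_surface_planar) blast+

  have harmonic: "harmonic_on_plane (?E \<circ> inv_into U \<phi>) (\<phi> ` (U \<inter> (?S - {q})))"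
    if "local_coordinate (top_of_set ?S) (planar_atlas ?S) (U, \<phi>)" for U \<phi>
  proof -
    note coord = local_coordinate_planarD[OF \<open>open ?S\<close> that]
    define g where "g = inv_into U \<phi>"
    define T where "T = \<phi> ` (U \<inter> (?S - {q}))"
    have "U \<inter> (?S - {q}) = U - {q}"
      using coord(1) by auto
    then have "T = \<phi> ` U - (if q \<in> U then {\<phi> q} else {})"
      using coord(4) by (auto simp: T_def inj_on_def)
    then have "open T"
      using coord(3) by (simp add: open_delete)
    have g: "g holomorphic_on T"
      unfolding g_def by (rule holomorphic_on_subset[OF coord(6)]) (auto simp: T_def)
    have g_ne: "g w \<noteq> 0" "g w \<noteq> q" if "w \<in> T" for w
      using that coord(4) by (auto simp: T_def g_def)
    \<comment> \<open>\<open>?F\<close> is the derivative of a local branch of \<open>Ln (g - q) - k * Ln g\<close>.\<close>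
    let ?F = "\<lambda>w. deriv g w / (g w - q) - of_real k * (deriv g w / g w)"
    have "harmonic_on_plane (?E \<circ> g) T"
    proof (rule harmonic_on_plane_of_holomorphic_gradient[OF \<open>open T\<close>])
      show "?F holomorphic_on T"
        using g_ne by (intro holomorphic_intros g \<open>open T\<close>) auto
      show "(?E \<circ> g has_derivative (\<lambda>h. Re (?F w * h))) (at w)" if "w \<in> T" for w
      proof -
        have dg: "(g has_field_derivative deriv g w) (at w)"
          by (rule holomorphic_derivI[OF g \<open>open T\<close> that])
        then have dgq: "((\<lambda>w. g w - q) has_field_derivative deriv g w) (at w)"
          by (auto intro!: derivative_eq_intros)
        have "((\<lambda>w. ln (cmod (g w - q)) - k * ln (cmod (g w)) - c) has_derivative
            (\<lambda>h. Re (deriv g w / (g w - q) * h) - k * Re (deriv g w / g w * h) - 0)) (at w)"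
          using g_ne[OF that]
          by (intro has_derivative_diff has_derivative_mult_right has_derivative_const
              has_derivative_ln_cmod dg dgq) auto
        moreover have "(\<lambda>h. Re (deriv g w / (g w - q) * h) - k * Re (deriv g w / g w * h) - 0)
            = (\<lambda>h. Re (?F w * h))"
        proof
          fix h
          have "?F w * h = deriv g w / (g w - q) * h - of_real k * (deriv g w / g w * h)"
            by (simp add: algebra_simps)
          then show "Re (deriv g w / (g w - q) * h) - k * Re (deriv g w / g w * h) - 0
              = Re (?F w * h)"
            by (simp only: minus_complex.sel scaleR_complex.sel diff_zero flip: scaleR_conv_of_real)
        qed
        ultimately have "((\<lambda>w. ln (cmod (g w - q)) - k * ln (cmod (g w)) - c) has_derivative
            (\<lambda>h. Re (?F w * h))) (at w)" by simp
        then show ?thesis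
          by (rule has_derivative_transform_within_open[OF _ \<open>open T\<close> that])
             (simp only: o_def E[OF g_ne])
      qed
    qed
    then show ?thesis
      by (simp only: g_def T_def)
  qed

  have pole: "\<exists>M. \<forall>\<^sub>F p in atin (top_of_set ?S) q. \<bar>?E p - ln (cmod (\<phi> p - \<phi> q))\<bar> \<le> M"
    if "local_coordinate (top_of_set ?S) (planar_atlas ?S) (U, \<phi>)" "q \<in> U" for U \<phi>
  proof -
    note coord = local_coordinate_planarD[OF \<open>open ?S\<close> that(1)]
    have "deriv \<phi> q \<noteq> 0"
      by (rule holomorphic_injective_imp_regular[OF coord(5,2,4) that(2)])
    have "((\<lambda>p. (\<phi> p - \<phi> q) / (p - q)) \<longlongrightarrow> deriv \<phi> q) (at q)"
      using holomorphic_derivI[OF coord(5,2) that(2)] by (simp add: has_field_derivative_iff)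
    then have "((\<lambda>p. - ln (cmod ((\<phi> p - \<phi> q) / (p - q))) - k * ln (cmod p) - c) \<longlongrightarrow>
        - ln (cmod (deriv \<phi> q)) - k * ln (cmod q) - c) (at q)"
      using \<open>deriv \<phi> q \<noteq> 0\<close> \<open>q \<noteq> 0\<close> by (intro tendsto_intros) auto
    then obtain M where
      "\<forall>\<^sub>F p in at q. \<bar>- ln (cmod ((\<phi> p - \<phi> q) / (p - q))) - k * ln (cmod p) - c\<bar> \<le> M"
      using eventually_abs_le_of_tendsto by blast
    moreover have "\<forall>\<^sub>F p in at q. p \<in> U - {q}"
      using coord(2) that(2) by (intro eventually_at_in_open)
    ultimately have "\<forall>\<^sub>F p in at q. \<bar>?E p - ln (cmod (\<phi> p - \<phi> q))\<bar> \<le> M"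
    proof eventually_elim
      case (elim p)
      then have "p \<noteq> 0" "p \<noteq> q" "\<phi> p \<noteq> \<phi> q"
        using coord(1,4) that(2) by (auto simp: inj_on_def)
      then have "?E p - ln (cmod (\<phi> p - \<phi> q))
          = - ln (cmod ((\<phi> p - \<phi> q) / (p - q))) - k * ln (cmod p) - c"
        unfolding E[OF \<open>p \<noteq> 0\<close> \<open>p \<noteq> q\<close>] by (simp add: norm_divide ln_div)
      then show ?case
        using elim by simp
    qed
    then obtain V where V: "open V" "q \<in> V"
      "\<And>p. p \<in> V \<Longrightarrow> p \<noteq> q \<Longrightarrow> \<bar>?E p - ln (cmod (\<phi> p - \<phi> q))\<bar> \<le> M"
      unfolding eventually_at_topological by blast
    have "openin (top_of_set ?S) (?S \<inter> V)" "q \<in> ?S \<inter> V"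
      using V \<open>q \<noteq> 0\<close> by (auto simp: openin_open_Int)
    then have "\<forall>\<^sub>F p in atin (top_of_set ?S) q. \<bar>?E p - ln (cmod (\<phi> p - \<phi> q))\<bar> \<le> M"
      unfolding eventually_atin using V(3) by blast
    then show ?thesis ..
  qed

  have at_0: "filterlim ?E at_top (at 0)"
  proof -
    have "filterlim (\<lambda>p::complex. cmod p) (at_right 0) (at 0)"
      by (auto simp: filterlim_at eventually_at_filter intro!: tendsto_eq_intros)
    then have "filterlim (\<lambda>p::complex. - ln (cmod p)) at_top (at 0)"
      using filterlim_compose[OF ln_at_0] by (simp add: filterlim_uminus_at_bot)
    then have "filterlim (\<lambda>p::complex. k * - ln (cmod p)) at_top (at 0)"
      using \<open>0 < k\<close> by (intro filterlim_tendsto_pos_mult_at_top[OF tendsto_const])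
    moreover have "((\<lambda>p. ln (cmod (p - q)) - c) \<longlongrightarrow> ln (cmod (0 - q)) - c) (at 0)"
      using \<open>q \<noteq> 0\<close> by (intro tendsto_intros) auto
    ultimately have "filterlim (\<lambda>p. (ln (cmod (p - q)) - c) + k * - ln (cmod p)) at_top (at 0)"
      by (rule filterlim_tendsto_add_at_top[rotated])
    moreover have "\<forall>\<^sub>F p in at 0. p \<in> - {q} - {0}"
      using \<open>q \<noteq> 0\<close> by (intro eventually_at_in_open) auto
    then have "\<forall>\<^sub>F p in at 0. (ln (cmod (p - q)) - c) + k * - ln (cmod p) = ?E p"
      by eventually_elim (use E in auto)
    ultimately show ?thesis
      by (simp add: filterlim_cong)
  qed

  have at_inf: "filterlim ?E at_top at_infinity"
  proof -
    have "filterlim (\<lambda>p::complex. ln (cmod p)) at_top at_infinity"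
      by (rule filterlim_compose[OF ln_at_top filterlim_norm_at_top])
    then have "filterlim (\<lambda>p::complex. (1 - k) * ln (cmod p)) at_top at_infinity"
      using \<open>k < 1\<close> by (intro filterlim_tendsto_pos_mult_at_top[OF tendsto_const]) auto
    \<comment> \<open>Writing \<open>|p - q| = |p| |1 - q / p|\<close> splits off the dominant term \<open>(1 - k) ln |p|\<close>.\<close>
    moreover have "((\<lambda>p. ln (cmod (1 - q / p)) - c) \<longlongrightarrow> ln (cmod (1 - 0)) - c) at_infinity"
      by (intro tendsto_intros tendsto_divide_0[OF tendsto_const] filterlim_ident) auto
    ultimately have
      "filterlim (\<lambda>p. (ln (cmod (1 - q / p)) - c) + (1 - k) * ln (cmod p)) at_top at_infinity"
      by (rule filterlim_tendsto_add_at_top[rotated])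
    moreover have "\<forall>\<^sub>F p in at_infinity. cmod p \<ge> cmod q + 1"
      unfolding eventually_at_infinity by blast
    then have "\<forall>\<^sub>F p in at_infinity.
        (ln (cmod (1 - q / p)) - c) + (1 - k) * ln (cmod p) = ?E p"
    proof eventually_elim
      case (elim p)
      then have "cmod q < cmod p" by simp
      then have "p \<noteq> 0" "p \<noteq> q" by auto
      then have "1 - q / p = (p - q) / p"
        by (simp add: field_simps)
      then have "ln (cmod (1 - q / p)) = ln (cmod (p - q)) - ln (cmod p)"
        using \<open>p \<noteq> 0\<close> \<open>p \<noteq> q\<close> by (simp add: norm_divide ln_div)
      then show ?case
        using E[OF \<open>p \<noteq> 0\<close> \<open>p \<noteq> q\<close>] by (simp add: algebra_simps)
    qed
    ultimately show ?thesis
      by (simp add: filterlim_cong)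
  qed

  show ?thesis
    unfolding evans_selberg_potential_def harmonic_on_surface_def
    using surface \<open>q \<noteq> 0\<close> harmonic pole
      filterlim_ideal_boundary_punctured_plane[OF at_0 at_inf]
    by (auto simp: openin_open_eq[OF \<open>open ?S\<close>] open_delete)
qed

end
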